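(* Let $\lambda\le\kappa$ be regular infinite cardinals and let $\mathcal F=\{F_\xi(\alpha):\xi<\lambda,\ \alpha<\kappa^+\}$ be a strong $(\kappa,\lambda)$-matrix indexed by $\kappa^+$. Then the topological group $G(\mathcal F)$ is $\lambda$-Fréchet if and only if $\mathcal F$ is unbounded.
   Context: Ordinals are identified with the set of smaller ordinals; $[X]^{<\omega}$ is the set of finite subsets of $X$; $\triangle$ is symmetric difference. For sets of ordinals $a,b$, write $a<b$ if $\alpha<\beta$ for all $\alpha\in a$, $\beta\in b$. Let $\lambda\le\kappa$ be infinite regular cardinals. A strong $(\kappa,\lambda)$-matrix indexed by $\kappa^+$ is a family $\mathcal F=\{F_\xi(\alpha):\alpha<\kappa^+,\ \xi<\lambda\}$ of sets such that: (G1) $\bigcup_{\xi<\lambda}F_\xi(\alpha)=\alpha$ for every $\alpha<\kappa^+$; (G2) $F_\xi(\alpha)\subseteq F_\eta(\alpha)$ for each $\alpha<\kappa^+$ and all $\xi\le\eta<\lambda$; (G3) for all $\alpha\le\beta<\kappa^+$ and each $\xi<\lambda$ there is $\eta<\lambda$ with $F_\xi(\alpha)\subseteq F_\eta(\beta)$; (G4) for all $\alpha\le\beta<\kappa^+$ and each $\eta<\lambda$ there is $\xi<\lambda$ with $F_\eta(\beta)\cap\alpha\subseteq F_\xi(\alpha)$. For $\xi<\lambda$ and $\alpha<\kappa^+$ put $U_\xi(\alpha)=\{a\in[\kappa^+]^{<\omega}: a\cap F_\xi(\alpha)=\emptyset\}$. $G(\mathcal F)$ denotes the topological group $([\kappa^+]^{<\omega},\triangle)$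 with the group topology for which $\{U_\xi(\alpha):\xi<\lambda,\ \alpha<\kappa^+\}$ is an open neighborhood base at the identity $\emptyset$. Define $\rho_{\mathcal F}:[\kappa^+]^2\to\lambda$ by $\rho_{\mathcal F}(\alpha,\beta)=\min\{\xi<\lambda:\alpha\in F_\xi(\beta)\}$ for $\alpha<\beta<\kappa^+$. The matrix $\mathcal F$ is unbounded if $\rho_{\mathcal F}$ is $\kappa^+$-unbounded, meaning: for every $\xi<\lambda$ and every family $\mathcal A$ of size $\kappa^+$ consisting of pairwise disjoint finite subsets of $\kappa^+$, there are distinct $a,b\in\mathcal A$ with $a<b$ such that $\rho_{\mathcal F}(\alpha,\beta)>\xi$ for all $\alpha\in a$ and $\beta\in b$. A topological group $G$ with identity $e$ is $\lambda$-Fréchet if for every $A\subseteq G$ with $e\in\overline A$ there is a $\lambda$-sequence $\langle x_\xi:\xi<\lambda\rangle$ in $A$ such that for every open $U\ni e$ there is $\eta<\lambda$ with $x_\xi\in U$ whenever $\eta\le\xi<\lambda$. *)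

theory Defs
  imports "HOL-Algebra.Group" "HOL-Analysis.Product_Topology"
begin

unbundle cardinal_syntax

text \<open>
  Cardinals and ordinals are represented as in the HOL theory of cardinal orders.
  A cardinal is a relation \<open>r\<close> with \<open>Card_order r\<close>.  The ordinals below it are the elements of
  \<open>Field r\<close>, \<open>(x, y) \<in> r\<close> means \<open>x \<le> y\<close>, and an ordinal \<open>\<alpha> \<in> Field r\<close>, regarded as
  the set of smaller ordinals, is \<open>underS r \<alpha>\<close>.
  Throughout, \<open>\<mu>\<close> plays the role of \<open>\<lambda>\<close> in the mathematical text, and \<open>\<theta>\<close> that of \<open>\<kappa>\<^sup>+\<close>:
  it is any well-order with \<open>\<theta> =o cardSuc \<kappa>\<close>.
\<close>

definition strong_matrix :: "'a rel \<Rightarrow> 'l rel \<Rightarrow> ('l \<Rightarrow> 'a \<Rightarrow> 'a set) \<Rightarrow> bool" where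
  "strong_matrix \<theta> \<mu> F \<longleftrightarrow>
     (\<forall>\<alpha>\<in>Field \<theta>. (\<Union>\<xi>\<in>Field \<mu>. F \<xi> \<alpha>) = underS \<theta> \<alpha>) \<and>
     (\<forall>\<alpha>\<in>Field \<theta>. \<forall>\<xi> \<eta>. (\<xi>, \<eta>) \<in> \<mu> \<longrightarrow> F \<xi> \<alpha> \<subseteq> F \<eta> \<alpha>) \<and>
     (\<forall>\<alpha> \<beta>. (\<alpha>, \<beta>) \<in> \<theta> \<longrightarrow> (\<forall>\<xi>\<in>Field \<mu>. \<exists>\<eta>\<in>Field \<mu>. F \<xi> \<alpha> \<subseteq> F \<eta> \<beta>)) \<and>
     (\<forall>\<alpha> \<beta>. (\<alpha>, \<beta>) \<in> \<theta> \<longrightarrow> (\<forall>\<eta>\<in>Field \<mu>. \<exists>\<xi>\<in>Field \<mu>. F \<eta> \<beta> \<inter> underS \<theta> \<alpha> \<subseteq> F \<xi> \<alpha>))"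

locale topological_group = group G for G (structure) +
  fixes T :: "'a topology"
  assumes topspace_eq: "topspace T = carrier G"
    and continuous_mult: "continuous_map (prod_topology T T) T (\<lambda>(x, y). x \<otimes> y)"
    and continuous_inv: "continuous_map T T (\<lambda>x. inv x)"

definition open_nhd_base :: "'a topology \<Rightarrow> 'a \<Rightarrow> 'a set set \<Rightarrow> bool" where
  "open_nhd_base T e \<B> \<longleftrightarrow>
     (\<forall>U\<in>\<B>. openin T U \<and> e \<in> U) \<and>
     (\<forall>V. openin T V \<and> e \<in> V \<longrightarrow> (\<exists>U\<in>\<B>. U \<subseteq> V))"

definition finset_group :: "'a set \<Rightarrow> 'a set monoid" where
  "finset_group X = \<lparr>carrier = Fpow X, monoid.mult = sym_diff, one = {}\<rparr>"

definition matrix_nhd :: "'a rel \<Rightarrow> ('l \<Rightarrow> 'a \<Rightarrow> 'a set) \<Rightarrow> 'l \<Rightarrow> 'a \<Rightarrow> 'a set set" where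
  "matrix_nhd \<theta> F \<xi> \<alpha> = {a \<in> Fpow (Field \<theta>). a \<inter> F \<xi> \<alpha> = {}}"

definition matrix_nhds :: "'a rel \<Rightarrow> 'l rel \<Rightarrow> ('l \<Rightarrow> 'a \<Rightarrow> 'a set) \<Rightarrow> 'a set set set" where
  "matrix_nhds \<theta> \<mu> F = {matrix_nhd \<theta> F \<xi> \<alpha> |\<xi> \<alpha>. \<xi> \<in> Field \<mu> \<and> \<alpha> \<in> Field \<theta>}"

text \<open>
  The group \<open>G(F)\<close> is \<open>finset_group (Field \<theta>)\<close> with the topology \<open>matrix_topology \<theta> \<mu> F\<close>;
  existence and uniqueness of this topology are \<open>ex1_matrix_topology\<close> below.
\<close>

definition matrix_topology :: "'a rel \<Rightarrow> 'l rel \<Rightarrow> ('l \<Rightarrow> 'a \<Rightarrow> 'a set) \<Rightarrow> 'a set topology" where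
  "matrix_topology \<theta> \<mu> F =
     (THE T. topological_group (finset_group (Field \<theta>)) T \<and> open_nhd_base T {} (matrix_nhds \<theta> \<mu> F))"

definition matrix_rho :: "'l rel \<Rightarrow> ('l \<Rightarrow> 'a \<Rightarrow> 'a set) \<Rightarrow> 'a \<Rightarrow> 'a \<Rightarrow> 'l" where
  "matrix_rho \<mu> F \<alpha> \<beta> = wo_rel.minim \<mu> {\<xi> \<in> Field \<mu>. \<alpha> \<in> F \<xi> \<beta>}"

text \<open>
  Here \<open>\<rho>\<close> is a function on pairs; only its values at pairs \<open>\<alpha> < \<beta>\<close> are used.
\<close>

definition unbounded_function :: "'a rel \<Rightarrow> 'l rel \<Rightarrow> ('a \<Rightarrow> 'a \<Rightarrow> 'l) \<Rightarrow> bool" where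
  "unbounded_function \<theta> \<mu> \<rho> \<longleftrightarrow>
     (\<forall>\<xi>\<in>Field \<mu>. \<forall>\<A>. \<A> \<subseteq> Fpow (Field \<theta>) \<and> disjoint \<A> \<and> |\<A>| =o \<theta> \<longrightarrow>
        (\<exists>a\<in>\<A>. \<exists>b\<in>\<A>. a \<noteq> b \<and> (\<forall>\<alpha>\<in>a. \<forall>\<beta>\<in>b. \<alpha> \<in> underS \<theta> \<beta>) \<and>
           (\<forall>\<alpha>\<in>a. \<forall>\<beta>\<in>b. \<xi> \<in> underS \<mu> (\<rho> \<alpha> \<beta>))))"

definition unbounded_matrix :: "'a rel \<Rightarrow> 'l rel \<Rightarrow> ('l \<Rightarrow> 'a \<Rightarrow> 'a set) \<Rightarrow> bool" where
  "unbounded_matrix \<theta> \<mu> F \<longleftrightarrow> unbounded_function \<theta> \<mu> (matrix_rho \<mu> F)"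

definition frechet_group :: "'l rel \<Rightarrow> ('a, 'b) monoid_scheme \<Rightarrow> 'a topology \<Rightarrow> bool" where
  "frechet_group \<mu> G T \<longleftrightarrow>
     (\<forall>A. A \<subseteq> carrier G \<and> \<one>\<^bsub>G\<^esub> \<in> T closure_of A \<longrightarrow>
        (\<exists>x. (\<forall>\<xi>\<in>Field \<mu>. x \<xi> \<in> A) \<and>
           (\<forall>U. openin T U \<and> \<one>\<^bsub>G\<^esub> \<in> U \<longrightarrow> (\<exists>\<eta>\<in>Field \<mu>. \<forall>\<xi>. (\<eta>, \<xi>) \<in> \<mu> \<longrightarrow> x \<xi> \<in> U))))"

lemma group_finset_group: "group (finset_group X)"
proof (rule groupI)
  fix x assume "x \<in> carrier (finset_group X)"
  then show "\<exists>y\<in>carrier (finset_group X). y \<otimes>\<^bsub>finset_group X\<^esub> x = \<one>\<^bsub>finset_group X\<^esub>"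
    by (intro bexI[of _ x]) (auto simp: finset_group_def)
qed (auto simp: finset_group_def Fpow_def)

lemma inv_finset_group:
  assumes "a \<in> Fpow X"
  shows "inv\<^bsub>finset_group X\<^esub> a = a"
proof -
  interpret group "finset_group X" by (rule group_finset_group)
  show ?thesis by (rule inv_equality) (use assms in \<open>auto simp: finset_group_def\<close>)
qed

lemma (in topological_group) openin_translate:
  assumes "a \<in> carrier G" "openin T V"
  shows "openin T {b \<in> carrier G. a \<otimes> b \<in> V}"
proof -
  have "continuous_map T (prod_topology T T) (\<lambda>b. (a, b))"
    using assms(1) topspace_eq by (intro continuous_map_pairedI) auto
  from continuous_map_compose[OF this continuous_mult]
  have "continuous_map T T (\<lambda>b. a \<otimes> b)" by (simp add: o_def)
  from openin_continuous_map_preimage[OF this assms(2)] show ?thesis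
    by (simp add: topspace_eq)
qed

lemma (in topological_group) openin_iff_base:
  assumes "open_nhd_base T \<one> \<B>"
  shows "openin T V \<longleftrightarrow>
    V \<subseteq> carrier G \<and> (\<forall>a\<in>V. \<exists>U\<in>\<B>. \<forall>b\<in>carrier G. inv a \<otimes> b \<in> U \<longrightarrow> b \<in> V)" (is "?L \<longleftrightarrow> ?R")
proof
  assume L: ?L
  have sub: "V \<subseteq> carrier G" using openin_subset[OF L] topspace_eq by simp
  moreover have "\<exists>U\<in>\<B>. \<forall>b\<in>carrier G. inv a \<otimes> b \<in> U \<longrightarrow> b \<in> V" if "a \<in> V" for a
  proof -
    have a: "a \<in> carrier G" using that sub by auto
    have "openin T {b \<in> carrier G. a \<otimes> b \<in> V}" using openin_translate[OF a L] .
    moreover have "\<one> \<in> {b \<in> carrier G. a \<otimes> b \<in> V}" using a that by simp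
    ultimately obtain U where U: "U \<in> \<B>" "U \<subseteq> {b \<in> carrier G. a \<otimes> b \<in> V}"
      using assms unfolding open_nhd_base_def by meson
    have "b \<in> V" if "b \<in> carrier G" "inv a \<otimes> b \<in> U" for b
    proof -
      have "a \<otimes> (inv a \<otimes> b) \<in> V" using U that by auto
      then show ?thesis using a that(1) by (simp add: m_assoc[symmetric])
    qed
    then show ?thesis using U(1) by blast
  qed
  ultimately show ?R by blast
next
  assume R: ?R
  show ?L
  proof (subst openin_subopen, intro ballI)
    fix a assume aV: "a \<in> V"
    then have a: "a \<in> carrier G" using R by auto
    obtain U where U: "U \<in> \<B>" "\<forall>b\<in>carrier G. inv a \<otimes> b \<in> U \<longrightarrow> b \<in> V" using R aV by blast
    have "openin T U" "\<one> \<in> U" using U(1) assms by (auto simp: open_nhd_base_def)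
    then have "openin T {b \<in> carrier G. inv a \<otimes> b \<in> U}"
      using openin_translate[of "inv a" U] a by simp
    then show "\<exists>W. openin T W \<and> a \<in> W \<and> W \<subseteq> V"
      using U(2) \<open>\<one> \<in> U\<close> a by (intro exI[of _ "{b \<in> carrier G. inv a \<otimes> b \<in> U}"]) auto
  qed
qed

lemma topological_group_base_unique:
  assumes "topological_group G T" "open_nhd_base T \<one>\<^bsub>G\<^esub> \<B>"
    and "topological_group G T'" "open_nhd_base T' \<one>\<^bsub>G\<^esub> \<B>"
  shows "T = T'"
  unfolding topology_eq
  using topological_group.openin_iff_base[OF assms(1,2)] topological_group.openin_iff_base[OF assms(3,4)]
  by simp

lemma matrix_nhds_directed:
  assumes "Well_order \<theta>" "Well_order \<mu>" "strong_matrix \<theta> \<mu> F"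
    and U: "U \<in> matrix_nhds \<theta> \<mu> F" and V: "V \<in> matrix_nhds \<theta> \<mu> F"
  shows "\<exists>W\<in>matrix_nhds \<theta> \<mu> F. W \<subseteq> U \<inter> V"
proof -
  interpret t: wo_rel \<theta> using assms(1) by (simp add: wo_rel_def)
  interpret m: wo_rel \<mu> using assms(2) by (simp add: wo_rel_def)
  have *: "\<exists>W\<in>matrix_nhds \<theta> \<mu> F. W \<subseteq> matrix_nhd \<theta> F \<xi> \<alpha> \<inter> matrix_nhd \<theta> F \<eta> \<beta>"
    if h: "\<xi> \<in> Field \<mu>" "\<eta> \<in> Field \<mu>" "(\<alpha>, \<beta>) \<in> \<theta>" for \<xi> \<eta> \<alpha> \<beta>
  proof -
    have b: "\<beta> \<in> Field \<theta>" using h(3) by (auto simp: Field_def)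
    obtain \<zeta> where z: "\<zeta> \<in> Field \<mu>" "F \<xi> \<alpha> \<subseteq> F \<zeta> \<beta>"
      using assms(3) h unfolding strong_matrix_def by blast
    have mx: "m.max2 \<zeta> \<eta> \<in> Field \<mu>" "(\<zeta>, m.max2 \<zeta> \<eta>) \<in> \<mu>" "(\<eta>, m.max2 \<zeta> \<eta>) \<in> \<mu>"
      using m.max2_greater_among[OF z(1) h(2)] m.max2_greater[OF z(1) h(2)] z(1) h(2) by auto
    then have "F \<zeta> \<beta> \<subseteq> F (m.max2 \<zeta> \<eta>) \<beta>" "F \<eta> \<beta> \<subseteq> F (m.max2 \<zeta> \<eta>) \<beta>"
      using assms(3) b unfolding strong_matrix_def by blast+
    then have "matrix_nhd \<theta> F (m.max2 \<zeta> \<eta>) \<beta> \<subseteq> matrix_nhd \<theta> F \<xi> \<alpha> \<inter> matrix_nhd \<theta> F \<eta> \<beta>"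
      using z(2) unfolding matrix_nhd_def by blast
    moreover have "matrix_nhd \<theta> F (m.max2 \<zeta> \<eta>) \<beta> \<in> matrix_nhds \<theta> \<mu> F"
      unfolding matrix_nhds_def using mx(1) b by blast
    ultimately show ?thesis by blast
  qed
  obtain \<xi> \<alpha> \<eta> \<beta> where h: "U = matrix_nhd \<theta> F \<xi> \<alpha>" "V = matrix_nhd \<theta> F \<eta> \<beta>"
    "\<xi> \<in> Field \<mu>" "\<eta> \<in> Field \<mu>" "\<alpha> \<in> Field \<theta>" "\<beta> \<in> Field \<theta>"
    using U V unfolding matrix_nhds_def by blast
  have "(\<alpha>, \<beta>) \<in> \<theta> \<or> (\<beta>, \<alpha>) \<in> \<theta>"
    using h(5,6) t.TOTALS by blast
  then show ?thesis
  proof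
    assume "(\<alpha>, \<beta>) \<in> \<theta>"
    from *[OF h(3,4) this] show ?thesis by (simp only: h(1,2))
  next
    assume "(\<beta>, \<alpha>) \<in> \<theta>"
    from *[OF h(4,3) this] show ?thesis by (simp only: h(1,2) Int_commute)
  qed
qed

lemma ex_matrix_topology:
  assumes "Well_order \<theta>" "Well_order \<mu>" "Field \<theta> \<noteq> {}" "Field \<mu> \<noteq> {}" "strong_matrix \<theta> \<mu> F"
  shows "\<exists>T. topological_group (finset_group (Field \<theta>)) T \<and> open_nhd_base T {} (matrix_nhds \<theta> \<mu> F)"
proof -
  define C where "C = Fpow (Field \<theta>)"
  define B where "B = matrix_nhds \<theta> \<mu> F"
  define d :: "'a set \<Rightarrow> 'a set \<Rightarrow> 'a set" where "d a b = sym_diff a b" for a b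
  have car: "carrier (finset_group (Field \<theta>)) = C" by (simp add: finset_group_def C_def)
  have mul: "monoid.mult (finset_group (Field \<theta>)) = d"
    by (intro ext) (simp add: finset_group_def d_def)
  have dC: "d a b \<in> C" if "a \<in> C" "b \<in> C" for a b
    using that by (auto simp: C_def Fpow_def d_def)
  have d0: "d {} b = b" "d b b = {}" for b by (auto simp: d_def)
  have d3: "d a b = d (d a c) (d c b)" for a b c by (auto simp: d_def)
  have d4: "d (d x y) (d p q) = d (d x p) (d y q)" for x y p q by (auto simp: d_def)
  have Bsub: "U \<subseteq> C" "{} \<in> U" if "U \<in> B" for U
    using that by (auto simp: B_def C_def matrix_nhds_def matrix_nhd_def Fpow_def)
  have Bd: "d a b \<in> U" if "U \<in> B" "a \<in> U" "b \<in> U" for U a b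
    using that by (auto simp: B_def matrix_nhds_def matrix_nhd_def Fpow_def d_def)
  have Bne: "B \<noteq> {}" using assms(3,4) by (auto simp: B_def matrix_nhds_def)
  have dir: "\<exists>W\<in>B. W \<subseteq> U \<inter> V" if "U \<in> B" "V \<in> B" for U V
    using matrix_nhds_directed[OF assms(1,2,5)] that unfolding B_def by blast
  define P where "P V \<longleftrightarrow> V \<subseteq> C \<and> (\<forall>a\<in>V. \<exists>U\<in>B. \<forall>b\<in>C. d a b \<in> U \<longrightarrow> b \<in> V)" for V
  have "istopology P"
    unfolding istopology_def
  proof (intro conjI allI impI)
    fix S T assume S: "P S" and T: "P T"
    have "\<exists>U\<in>B. \<forall>b\<in>C. d a b \<in> U \<longrightarrow> b \<in> S \<inter> T" if "a \<in> S \<inter> T" for a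
    proof -
      obtain U V where "U \<in> B" "\<forall>b\<in>C. d a b \<in> U \<longrightarrow> b \<in> S"
        "V \<in> B" "\<forall>b\<in>C. d a b \<in> V \<longrightarrow> b \<in> T"
        using S T \<open>a \<in> S \<inter> T\<close> unfolding P_def by blast
      with dir[of U V] show ?thesis by blast
    qed
    then show "P (S \<inter> T)" using S unfolding P_def by blast
  next
    fix \<K> assume K: "\<forall>K\<in>\<K>. P K"
    have "\<exists>U\<in>B. \<forall>b\<in>C. d a b \<in> U \<longrightarrow> b \<in> \<Union>\<K>" if a: "a \<in> \<Union>\<K>" for a
    proof -
      obtain K where "K \<in> \<K>" "a \<in> K" using a by blast
      moreover from this K obtain U where "U \<in> B" "\<forall>b\<in>C. d a b \<in> U \<longrightarrow> b \<in> K"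
        unfolding P_def by blast
      ultimately show ?thesis by blast
    qed
    then show "P (\<Union>\<K>)" using K unfolding P_def by blast
  qed
  define T where "T = topology P"
  have op: "openin T = P" unfolding T_def using \<open>istopology P\<close> by (rule topology_inverse')
  have "P C" using Bne unfolding P_def by blast
  then have top: "topspace T = C"
    using openin_subset[of T C] openin_topspace[of T] unfolding op by (auto simp: P_def)
  have coset: "P {b \<in> C. d a b \<in> U}" if "U \<in> B" "a \<in> C" for a U
    unfolding P_def
  proof (intro conjI ballI bexI[OF _ \<open>U \<in> B\<close>] impI)
    fix c b assume c: "c \<in> {b \<in> C. d a b \<in> U}" and b: "b \<in> C" "d c b \<in> U"
    have "d a b = d (d a c) (d c b)" by (rule d3)
    also have "\<dots> \<in> U" using Bd[OF that(1)] c b(2) by blast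
    finally show "b \<in> {b \<in> C. d a b \<in> U}" using b by simp
  qed auto
  have nb: "open_nhd_base T {} B"
    unfolding open_nhd_base_def op
  proof (intro conjI ballI allI impI)
    fix U assume U: "U \<in> B"
    have "{b \<in> C. d {} b \<in> U} = U" using Bsub[OF U] by (auto simp: d0)
    then show "P U" using coset[OF U, of "{}"] Bsub[OF U] by (auto simp: subset_iff)
    show "{} \<in> U" using Bsub[OF U] by simp
  next
    fix V assume V: "P V \<and> {} \<in> V"
    then obtain U where "U \<in> B" "\<forall>b\<in>C. d {} b \<in> U \<longrightarrow> b \<in> V" unfolding P_def by blast
    then show "\<exists>U\<in>B. U \<subseteq> V" using Bsub[of U] by (intro bexI[of _ U]) (auto simp: d0)
  qed
  have mult: "continuous_map (prod_topology T T) T (\<lambda>(x, y). d x y)"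
    unfolding continuous_map_def
  proof (intro conjI allI impI)
    show "(\<lambda>(x, y). d x y) \<in> topspace (prod_topology T T) \<rightarrow> topspace T"
      using dC by (auto simp: top)
  next
    fix V assume "openin T V"
    then have V: "P V" by (simp add: op)
    show "openin (prod_topology T T)
        {p \<in> topspace (prod_topology T T). (case p of (x, y) \<Rightarrow> d x y) \<in> V}"
      unfolding openin_prod_topology_alt
    proof (intro allI impI)
      fix x y assume "(x, y) \<in> {p \<in> topspace (prod_topology T T). (case p of (x, y) \<Rightarrow> d x y) \<in> V}"
      then have xy: "x \<in> C" "y \<in> C" "d x y \<in> V" by (auto simp: top)
      obtain U where U: "U \<in> B" "\<forall>b\<in>C. d (d x y) b \<in> U \<longrightarrow> b \<in> V"
        using V xy(3) unfolding P_def by blast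
      let ?X = "{b \<in> C. d x b \<in> U}" and ?Y = "{b \<in> C. d y b \<in> U}"
      have "d p q \<in> V" if "p \<in> ?X" "q \<in> ?Y" for p q
      proof -
        have "d (d x y) (d p q) = d (d x p) (d y q)" by (rule d4)
        also have "\<dots> \<in> U" using Bd[OF U(1)] that by blast
        finally show ?thesis using U(2) dC that by blast
      qed
      moreover have "openin T ?X" "openin T ?Y" using coset[OF U(1)] xy by (auto simp: op)
      moreover have "x \<in> ?X" "y \<in> ?Y" using Bsub[OF U(1)] xy by (auto simp: d0)
      ultimately show "\<exists>X Y. openin T X \<and> openin T Y \<and> x \<in> X \<and> y \<in> Y \<and>
          X \<times> Y \<subseteq> {p \<in> topspace (prod_topology T T). (case p of (x, y) \<Rightarrow> d x y) \<in> V}"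
        by (intro exI[of _ ?X] exI[of _ ?Y]) (auto simp: top)
    qed
  qed
  have inv: "continuous_map T T (\<lambda>x. inv\<^bsub>finset_group (Field \<theta>)\<^esub> x)"
    by (rule continuous_map_eq[of T T "\<lambda>x. x"]) (auto simp: top C_def inv_finset_group)
  have "topological_group (finset_group (Field \<theta>)) T"
    unfolding topological_group_def topological_group_axioms_def
    using group_finset_group top mult inv by (simp add: car mul)
  then show ?thesis using nb unfolding B_def by blast
qed

lemma ex1_matrix_topology:
  assumes "Well_order \<theta>" "Well_order \<mu>" "Field \<theta> \<noteq> {}" "Field \<mu> \<noteq> {}" "strong_matrix \<theta> \<mu> F"
  shows "\<exists>!T. topological_group (finset_group (Field \<theta>)) T \<and> open_nhd_base T {} (matrix_nhds \<theta> \<mu> F)"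
proof -
  have "\<one>\<^bsub>finset_group (Field \<theta>)\<^esub> = {}" by (simp add: finset_group_def)
  then show ?thesis
    using ex_matrix_topology[OF assms] topological_group_base_unique[of "finset_group (Field \<theta>)"]
    by metis
qed

lemma matrix_topology:
  assumes "Well_order \<theta>" "Well_order \<mu>" "Field \<theta> \<noteq> {}" "Field \<mu> \<noteq> {}" "strong_matrix \<theta> \<mu> F"
  shows "topological_group (finset_group (Field \<theta>)) (matrix_topology \<theta> \<mu> F)"
    and "open_nhd_base (matrix_topology \<theta> \<mu> F) {} (matrix_nhds \<theta> \<mu> F)"
  using theI'[OF ex1_matrix_topology[OF assms]] unfolding matrix_topology_def by blast+

end

theory Submission
  imports Defs
begin

text \<open>
  If \<open>\<F>\<close> is unbounded, \<open>\<emptyset>\<close> is in the closure of \<open>A\<close>, and some \<open>\<alpha>\<close> is such that already the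
  members of \<open>A\<close> contained in \<open>\<alpha>\<close> avoid each single \<open>F\<^sub>\<xi>(\<alpha>)\<close>, then choosing one of them for every
  \<open>\<xi>\<close> gives a convergent sequence, by (G3) and (G4).  Otherwise every \<open>\<alpha>\<close> has a \<open>\<xi>\<close> such that
  all members of \<open>A\<close> below \<open>\<alpha>\<close> meet \<open>F\<^sub>\<xi>(\<alpha>)\<close>; fix the same \<open>\<xi>\<close> for \<open>\<kappa>\<^sup>+\<close> many \<open>\<alpha>\<close>, choose
  \<open>a\<^sub>\<alpha> \<in> A\<close> missing \<open>F\<^sub>\<xi>(\<alpha>)\<close>, and thin out the sets \<open>a\<^sub>\<alpha> \<union> {\<alpha>}\<close> to a \<open>\<Delta>\<close>-system.
  Unboundedness for the petals yields \<open>\<alpha> < \<beta>\<close> with \<open>a\<^sub>\<alpha> \<subseteq> \<beta>\<close> missing \<open>F\<^sub>\<xi>(\<beta>)\<close>, a contradiction.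

  Conversely, a disjoint family \<open>\<A>\<close> witnessing that \<open>\<F>\<close> is not unbounded has \<open>\<emptyset>\<close> in its closure.
  A sequence in \<open>\<A>\<close> lies below some \<open>b \<in> \<A>\<close>, so each of its terms meets the union of the finitely
  many \<open>F\<^sub>\<xi>(\<beta>)\<close>, \<open>\<beta> \<in> b\<close>, and the sequence does not converge.
\<close>

section \<open>Counting below a regular cardinal\<close>

lemma UNION_ordLess_regularCard:
  assumes "Cinfinite r" "regularCard r" "|I| <o r" "\<And>i. i \<in> I \<Longrightarrow> |A i| <o r"
  shows "|\<Union>i\<in>I. A i| <o r"
  using assms by (intro card_of_UNION_ordLess_infinite_Field_regularCard) auto

text \<open>By regularity, fewer than \<open>r\<close> fibres with fewer than \<open>r\<close>
  elements each cannot exhaust \<open>I\<close>. Here and below, \<open>\<not> |I| <o r\<close>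
  expresses that \<open>I\<close> has at least \<open>r\<close> elements.\<close>

lemma pigeonhole_regularCard:
  assumes r: "Cinfinite r" "regularCard r"
    and I: "\<not> |I| <o r" and B: "|B| <o r" and f: "f ` I \<subseteq> B"
  shows "\<exists>b\<in>B. \<not> |{i \<in> I. f i = b}| <o r"
proof (rule ccontr)
  assume none: "\<not> ?thesis"
  have "|\<Union>b\<in>B. {i \<in> I. f i = b}| <o r"
    by (rule UNION_ordLess_regularCard[OF r B]) (use none in simp)
  moreover have "(\<Union>b\<in>B. {i \<in> I. f i = b}) = I" using f by auto
  ultimately show False using I by simp
qed

lemma card_of_finite_ordLess_Cinfinite:
  assumes "Cinfinite r" "finite A"
  shows "|A| <o r"
proof (rule finite_ordLess_infinite)
  show "Well_order |A|" by (rule card_of_Well_order)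
  show "Well_order r" using assms(1) card_order_on_well_order_on by blast
qed (use assms in \<open>simp_all add: cinfinite_def Field_card_of\<close>)

lemma ordLess_Un_Cinfinite:
  assumes "Cinfinite r" "|A| <o r" "|B| <o r"
  shows "|A \<union> B| <o r"
  using assms card_of_Un_ordLess_infinite_Field[of r A B] by (simp add: cinfinite_def)

lemma not_ordLess_diff:
  assumes "Cinfinite r" "\<not> |I| <o r" "|B| <o r" "I \<subseteq> J \<union> B"
  shows "\<not> |J| <o r"
  using assms ordLess_Un_Cinfinite[of r J B] card_of_mono1[OF assms(4)] ordLeq_ordLess_trans
  by blast

lemma ordLess_mono: "A \<subseteq> B \<Longrightarrow> |B| <o r \<Longrightarrow> |A| <o r"
  using card_of_mono1 ordLeq_ordLess_trans by blast

section \<open>Delta-systems and large disjoint families of finite sets\<close>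

text \<open>Induction on the common size \<open>n\<close>. A point lying in \<open>r\<close> many of
  the sets is removed and later put into the root. If there is no such point, a maximal disjoint
  subfamily already has at least \<open>r\<close> members: otherwise its union would have fewer than
  \<open>r\<close> points, each in fewer than \<open>r\<close> of the sets, although by maximality
  every set meets this union.\<close>

lemma delta_system_card:
  fixes a :: "'i \<Rightarrow> 'b set"
  assumes r: "Cinfinite r" "regularCard r"
  shows "\<not> |I| <o r \<Longrightarrow> \<forall>i\<in>I. finite (a i) \<and> card (a i) = n \<Longrightarrow>
    \<exists>J R. J \<subseteq> I \<and> \<not> |J| <o r \<and> (\<forall>i\<in>J. \<forall>j\<in>J. i \<noteq> j \<longrightarrow> a i \<inter> a j = R)"
proof (induction n arbitrary: a I)
  case 0
  then show ?case by (intro exI[of _ I] exI[of _ "{}"]) auto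
next
  case (Suc n)
  show ?case
  proof (cases "\<exists>x. \<not> |{i \<in> I. x \<in> a i}| <o r")
    case True
    then obtain x where x: "\<not> |{i \<in> I. x \<in> a i}| <o r" by blast
    obtain J R where J: "J \<subseteq> {i \<in> I. x \<in> a i}" "\<not> |J| <o r"
      "\<forall>i\<in>J. \<forall>j\<in>J. i \<noteq> j \<longrightarrow> (a i - {x}) \<inter> (a j - {x}) = R"
      using Suc.IH[OF x, of "\<lambda>i. a i - {x}"] Suc.prems(2) by auto
    have "a i \<inter> a j = insert x R" if "i \<in> J" "j \<in> J" "i \<noteq> j" for i j
      using J(1,3) that by blast
    then show ?thesis using J(1,2) by (intro exI[of _ J] exI[of _ "insert x R"]) auto
  next
    case False
    define S where "S = {J. J \<subseteq> I \<and> disjoint_family_on a J}"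
    have "\<exists>M\<in>S. \<forall>X\<in>S. M \<subseteq> X \<longrightarrow> X = M"
    proof (rule subset_Zorn')
      fix C assume C: "subset.chain S C"
      have "disjoint_family_on a (\<Union>C)"
        unfolding disjoint_family_on_def
      proof (intro ballI impI)
        fix i j assume "i \<in> \<Union>C" "j \<in> \<Union>C" "i \<noteq> j"
        then obtain X where "X \<in> C" "i \<in> X" "j \<in> X"
          using C unfolding subset_chain_def by blast
        then show "a i \<inter> a j = {}"
          using C \<open>i \<noteq> j\<close> unfolding subset_chain_def S_def disjoint_family_on_def by blast
      qed
      then show "\<Union>C \<in> S" using C unfolding S_def subset_chain_def by blast
    qed
    then obtain M where M: "M \<in> S" "\<And>X. X \<in> S \<Longrightarrow> M \<subseteq> X \<Longrightarrow> X = M" by blast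
    have "\<not> |M| <o r"
    proof
      assume small: "|M| <o r"
      have "|a i| <o r" if "i \<in> M" for i
        using that M(1) Suc.prems(2) r(1)
        by (intro card_of_finite_ordLess_Cinfinite) (auto simp: S_def)
      then have "|\<Union>i\<in>M. a i| <o r" by (rule UNION_ordLess_regularCard[OF r small])
      then have "|\<Union>x\<in>(\<Union>i\<in>M. a i). {i \<in> I. x \<in> a i}| <o r"
        by (rule UNION_ordLess_regularCard[OF r]) (use False in simp)
      moreover have "I \<subseteq> (\<Union>x\<in>(\<Union>i\<in>M. a i). {i \<in> I. x \<in> a i})"
      proof
        fix i assume i: "i \<in> I"
        have "\<exists>j\<in>M. a i \<inter> a j \<noteq> {}"
        proof (rule ccontr)
          assume none: "\<not> ?thesis"
          then have "insert i M \<in> S"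
            using M(1) i unfolding S_def disjoint_family_on_def by blast
          then have "i \<in> M" using M(2)[of "insert i M"] by blast
          \<comment> \<open>The size is \<open>Suc n\<close>, so the set is nonempty and, for
            \<open>i\<close> in \<open>M\<close>, it meets itself: \<open>i\<close> can serve as its
            own \<open>j\<close>.\<close>
          moreover have "a i \<noteq> {}" using Suc.prems(2) i by force
          ultimately show False using none by blast
        qed
        then show "i \<in> (\<Union>x\<in>(\<Union>i\<in>M. a i). {i \<in> I. x \<in> a i})" using i by blast
      qed
      ultimately show False using Suc.prems(1) ordLess_mono by blast
    qed
    then show ?thesis
      using M(1) unfolding S_def disjoint_family_on_def
      by (intro exI[of _ M] exI[of _ "{}"]) auto
  qed
qed

text \<open>There are only countably many finite sizes, so for uncountable regular \<open>r\<close>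
  one size is shared by \<open>r\<close> many indices.\<close>

lemma delta_system:
  fixes a :: "'i \<Rightarrow> 'b set"
  assumes r: "Cinfinite r" "regularCard r" "natLeq <o r"
    and I: "\<not> |I| <o r" and fin: "\<And>i. i \<in> I \<Longrightarrow> finite (a i)"
  obtains J R where "J \<subseteq> I" "\<not> |J| <o r" "\<And>i j. i \<in> J \<Longrightarrow> j \<in> J \<Longrightarrow> i \<noteq> j \<Longrightarrow> a i \<inter> a j = R"
proof -
  have "|UNIV :: nat set| <o r" using r(3) card_of_nat ordIso_ordLess_trans by blast
  from pigeonhole_regularCard[OF r(1,2) I this, of "\<lambda>i. card (a i)"]
  obtain n where "\<not> |{i \<in> I. card (a i) = n}| <o r" by auto
  from delta_system_card[OF r(1,2) this, of a n] fin
  obtain J R where "J \<subseteq> {i \<in> I. card (a i) = n}" "\<not> |J| <o r"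
    "\<forall>i\<in>J. \<forall>j\<in>J. i \<noteq> j \<longrightarrow> a i \<inter> a j = R"
    by auto
  then show thesis by (intro that[of J R]) auto
qed

text \<open>If every nonempty member met \<open>Y\<close>, choosing a point of intersection from
  each would, by disjointness, inject the nonempty members into \<open>Y\<close>. The empty set can
  add only one further member.\<close>

lemma ex_disjoint_member_avoiding:
  assumes r: "Cinfinite r" and \<A>: "disjoint \<A>" "\<not> |\<A>| <o r" and Y: "|Y| <o r"
  shows "\<exists>b\<in>\<A>. b \<noteq> {} \<and> b \<inter> Y = {}"
proof (rule ccontr)
  assume "\<not> ?thesis"
  then have "\<forall>b\<in>\<A> - {{}}. \<exists>y. y \<in> b \<inter> Y" by blast
  then obtain f where f: "\<forall>b\<in>\<A> - {{}}. f b \<in> b \<inter> Y" by metis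
  have "inj_on f (\<A> - {{}})"
    using f \<A>(1) unfolding inj_on_def disjoint_def by (metis DiffD1 IntE IntI empty_iff)
  then have "|\<A> - {{}}| \<le>o |Y|" using f by (intro card_of_ordLeqI[of f]) auto
  then have "|\<A> - {{}}| <o r" using Y ordLeq_ordLess_trans by blast
  then show False
    using not_ordLess_diff[OF r \<A>(2) card_of_finite_ordLess_Cinfinite[OF r], of "{{}}" "\<A> - {{}}"]
    by blast
qed

section \<open>Closure and convergence at the identity in terms of the matrix\<close>

lemma in_closure_of_iff_base:
  assumes "open_nhd_base T e \<B>" "e \<in> topspace T"
  shows "e \<in> Abstract_Topology.closure_of T A \<longleftrightarrow> (\<forall>U\<in>\<B>. \<exists>a\<in>A. a \<in> U)"
proof
  assume "e \<in> Abstract_Topology.closure_of T A"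
  then have "\<exists>a. a \<in> A \<and> a \<in> V" if "e \<in> V" "openin T V" for V
    using that unfolding in_closure_of by blast
  then show "\<forall>U\<in>\<B>. \<exists>a\<in>A. a \<in> U" using assms(1) unfolding open_nhd_base_def by meson
next
  assume meets: "\<forall>U\<in>\<B>. \<exists>a\<in>A. a \<in> U"
  have "\<exists>a. a \<in> A \<and> a \<in> V" if V: "e \<in> V" "openin T V" for V
  proof -
    obtain U where "U \<in> \<B>" "U \<subseteq> V" using assms(1) V unfolding open_nhd_base_def by meson
    then show ?thesis using meets by blast
  qed
  then show "e \<in> Abstract_Topology.closure_of T A" using assms(2) by (simp add: in_closure_of)
qed

text \<open>This removes the topology: closure and convergence at \<open>{}\<close> can be tested on
  basic neighborhoods, and membership of a finite set in one of them is disjointness from some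
  \<open>F \<xi> \<alpha>\<close>. Both implications are proved in this form.\<close>

lemma frechet_group_matrix_iff:
  assumes "Well_order \<theta>" "Well_order \<mu>" "Field \<theta> \<noteq> {}" "Field \<mu> \<noteq> {}" "strong_matrix \<theta> \<mu> F"
  shows "frechet_group \<mu> (finset_group (Field \<theta>)) (matrix_topology \<theta> \<mu> F) \<longleftrightarrow>
    (\<forall>A\<subseteq>Fpow (Field \<theta>). (\<forall>\<xi>\<in>Field \<mu>. \<forall>\<alpha>\<in>Field \<theta>. \<exists>a\<in>A. a \<inter> F \<xi> \<alpha> = {}) \<longrightarrow>
      (\<exists>x. (\<forall>\<zeta>\<in>Field \<mu>. x \<zeta> \<in> A) \<and>
        (\<forall>\<xi>\<in>Field \<mu>. \<forall>\<alpha>\<in>Field \<theta>. \<exists>\<eta>\<in>Field \<mu>. \<forall>\<zeta>. (\<eta>, \<zeta>) \<in> \<mu> \<longrightarrow> x \<zeta> \<inter> F \<xi> \<alpha> = {})))"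
proof -
  let ?T = "matrix_topology \<theta> \<mu> F" and ?G = "finset_group (Field \<theta>)"
  have one: "\<one>\<^bsub>?G\<^esub> = {}" and car: "carrier ?G = Fpow (Field \<theta>)" by (simp_all add: finset_group_def)
  have base: "open_nhd_base ?T {} (matrix_nhds \<theta> \<mu> F)" using matrix_topology[OF assms] by blast
  have "topspace ?T = carrier ?G"
    using topological_group.topspace_eq matrix_topology(1)[OF assms] by blast
  then have e: "{} \<in> topspace ?T" by (simp add: car Fpow_def)
  have cl: "{} \<in> Abstract_Topology.closure_of ?T A \<longleftrightarrow> (\<forall>\<xi>\<in>Field \<mu>. \<forall>\<alpha>\<in>Field \<theta>. \<exists>a\<in>A. a \<inter> F \<xi> \<alpha> = {})"
    if "A \<subseteq> Fpow (Field \<theta>)" for A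
  proof -
    have "a \<in> matrix_nhd \<theta> F \<xi> \<alpha> \<longleftrightarrow> a \<inter> F \<xi> \<alpha> = {}" if "a \<in> A" for a \<xi> \<alpha>
      using \<open>A \<subseteq> _\<close> that by (auto simp: matrix_nhd_def)
    then have "(\<exists>a\<in>A. a \<in> matrix_nhd \<theta> F \<xi> \<alpha>) \<longleftrightarrow> (\<exists>a\<in>A. a \<inter> F \<xi> \<alpha> = {})" for \<xi> \<alpha>
      by (intro bex_cong refl)
    moreover have "(\<forall>U\<in>matrix_nhds \<theta> \<mu> F. P U) \<longleftrightarrow>
        (\<forall>\<xi>\<in>Field \<mu>. \<forall>\<alpha>\<in>Field \<theta>. P (matrix_nhd \<theta> F \<xi> \<alpha>))" for P
      unfolding matrix_nhds_def by blast
    ultimately show ?thesis by (simp add: in_closure_of_iff_base[OF base e])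
  qed
  have conv: "(\<forall>U. openin ?T U \<and> {} \<in> U \<longrightarrow> (\<exists>\<eta>\<in>Field \<mu>. \<forall>\<zeta>. (\<eta>, \<zeta>) \<in> \<mu> \<longrightarrow> x \<zeta> \<in> U)) \<longleftrightarrow>
      (\<forall>\<xi>\<in>Field \<mu>. \<forall>\<alpha>\<in>Field \<theta>. \<exists>\<eta>\<in>Field \<mu>. \<forall>\<zeta>. (\<eta>, \<zeta>) \<in> \<mu> \<longrightarrow> x \<zeta> \<inter> F \<xi> \<alpha> = {})"
    (is "?L \<longleftrightarrow> ?R") if x: "A \<subseteq> Fpow (Field \<theta>)" "\<forall>\<zeta>\<in>Field \<mu>. x \<zeta> \<in> A" for x A
  proof
    assume L: ?L
    show ?R
    proof (intro ballI)
      fix \<xi> \<alpha> assume "\<xi> \<in> Field \<mu>" "\<alpha> \<in> Field \<theta>"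
      then have "matrix_nhd \<theta> F \<xi> \<alpha> \<in> matrix_nhds \<theta> \<mu> F" unfolding matrix_nhds_def by blast
      with base L obtain \<eta> where "\<eta> \<in> Field \<mu>" "\<forall>\<zeta>. (\<eta>, \<zeta>) \<in> \<mu> \<longrightarrow> x \<zeta> \<in> matrix_nhd \<theta> F \<xi> \<alpha>"
        unfolding open_nhd_base_def by meson
      then show "\<exists>\<eta>\<in>Field \<mu>. \<forall>\<zeta>. (\<eta>, \<zeta>) \<in> \<mu> \<longrightarrow> x \<zeta> \<inter> F \<xi> \<alpha> = {}"
        unfolding matrix_nhd_def by blast
    qed
  next
    assume R: ?R
    show ?L
    proof (intro allI impI)
      fix U assume "openin ?T U \<and> {} \<in> U"
      then obtain V where "V \<in> matrix_nhds \<theta> \<mu> F" "V \<subseteq> U"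
        using base unfolding open_nhd_base_def by blast
      then obtain \<xi> \<alpha> where h: "\<xi> \<in> Field \<mu>" "\<alpha> \<in> Field \<theta>" "matrix_nhd \<theta> F \<xi> \<alpha> \<subseteq> U"
        unfolding matrix_nhds_def by blast
      then obtain \<eta> where \<eta>: "\<eta> \<in> Field \<mu>" "\<forall>\<zeta>. (\<eta>, \<zeta>) \<in> \<mu> \<longrightarrow> x \<zeta> \<inter> F \<xi> \<alpha> = {}"
        using R by blast
      have "x \<zeta> \<in> U" if "(\<eta>, \<zeta>) \<in> \<mu>" for \<zeta>
      proof -
        have "\<zeta> \<in> Field \<mu>" using that by (auto simp: Field_def)
        then have "x \<zeta> \<in> matrix_nhd \<theta> F \<xi> \<alpha>"
          using x \<eta>(2) that unfolding matrix_nhd_def by blast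
        then show ?thesis using h(3) by blast
      qed
      then show "\<exists>\<eta>\<in>Field \<mu>. \<forall>\<zeta>. (\<eta>, \<zeta>) \<in> \<mu> \<longrightarrow> x \<zeta> \<in> U" using \<eta>(1) by blast
    qed
  qed
  show ?thesis
    unfolding frechet_group_def one car
  proof (intro all_cong1)
    fix A
    show "(A \<subseteq> Fpow (Field \<theta>) \<and> {} \<in> Abstract_Topology.closure_of ?T A \<longrightarrow>
        (\<exists>x. (\<forall>\<zeta>\<in>Field \<mu>. x \<zeta> \<in> A) \<and>
          (\<forall>U. openin ?T U \<and> {} \<in> U \<longrightarrow> (\<exists>\<eta>\<in>Field \<mu>. \<forall>\<zeta>. (\<eta>, \<zeta>) \<in> \<mu> \<longrightarrow> x \<zeta> \<in> U)))) =
      (A \<subseteq> Fpow (Field \<theta>) \<longrightarrow> (\<forall>\<xi>\<in>Field \<mu>. \<forall>\<alpha>\<in>Field \<theta>. \<exists>a\<in>A. a \<inter> F \<xi> \<alpha> = {}) \<longrightarrow>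
        (\<exists>x. (\<forall>\<zeta>\<in>Field \<mu>. x \<zeta> \<in> A) \<and>
          (\<forall>\<xi>\<in>Field \<mu>. \<forall>\<alpha>\<in>Field \<theta>. \<exists>\<eta>\<in>Field \<mu>. \<forall>\<zeta>. (\<eta>, \<zeta>) \<in> \<mu> \<longrightarrow> x \<zeta> \<inter> F \<xi> \<alpha> = {})))"
      \<comment> \<open>\<open>conv\<close> presupposes that the values of \<open>x\<close> lie in
        \<open>A\<close>; \<open>conj_cong\<close> supplies this from the first conjunct.\<close>
      using cl[of A] conv[of A] by (cases "A \<subseteq> Fpow (Field \<theta>)") (simp_all cong: conj_cong)
  qed
qed

section \<open>Unboundedness in terms of the matrix\<close>

text \<open>By (G1) and (G2) the levels \<open>\<eta>\<close> with \<open>\<alpha>\<close> in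
  \<open>F \<eta> \<beta>\<close> form a nonempty final segment, whose least element is
  \<open>matrix_rho \<mu> F \<alpha> \<beta>\<close>.\<close>

lemma less_matrix_rho_iff:
  assumes "Well_order \<mu>" "strong_matrix \<theta> \<mu> F"
    and \<xi>: "\<xi> \<in> Field \<mu>" and \<beta>: "\<beta> \<in> Field \<theta>" and \<alpha>: "\<alpha> \<in> underS \<theta> \<beta>"
  shows "\<xi> \<in> underS \<mu> (matrix_rho \<mu> F \<alpha> \<beta>) \<longleftrightarrow> \<alpha> \<notin> F \<xi> \<beta>"
proof -
  interpret m: wo_rel \<mu> using assms(1) by (simp add: wo_rel_def)
  let ?B = "{\<eta> \<in> Field \<mu>. \<alpha> \<in> F \<eta> \<beta>}"
  have "?B \<noteq> {}" using assms(2) \<alpha> \<beta> unfolding strong_matrix_def by blast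
  then have in_B: "m.minim ?B \<in> ?B" by (intro m.minim_in) auto
  have "\<alpha> \<in> F \<xi> \<beta> \<longleftrightarrow> (m.minim ?B, \<xi>) \<in> \<mu>"
  proof
    show "\<alpha> \<in> F \<xi> \<beta> \<Longrightarrow> (m.minim ?B, \<xi>) \<in> \<mu>" using \<xi> by (intro m.minim_least) auto
    assume "(m.minim ?B, \<xi>) \<in> \<mu>"
    then have "F (m.minim ?B) \<beta> \<subseteq> F \<xi> \<beta>" using assms(2) \<beta> unfolding strong_matrix_def by blast
    then show "\<alpha> \<in> F \<xi> \<beta>" using in_B by blast
  qed
  moreover have "\<xi> \<in> underS \<mu> (m.minim ?B) \<longleftrightarrow> (m.minim ?B, \<xi>) \<notin> \<mu>"
    using in_B \<xi> m.TOTALS m.ANTISYM m.REFL unfolding underS_def antisym_def refl_on_def by blast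
  ultimately show ?thesis unfolding matrix_rho_def by blast
qed

text \<open>The order condition and the bound on \<open>\<rho>\<close> merge into one inclusion,
  which mentions neither minima nor the order of \<open>\<mu>\<close> and can be compared directly
  with basic neighborhoods.\<close>

lemma unbounded_matrix_iff:
  assumes "Well_order \<mu>" "strong_matrix \<theta> \<mu> F"
  shows "unbounded_matrix \<theta> \<mu> F \<longleftrightarrow>
    (\<forall>\<xi>\<in>Field \<mu>. \<forall>\<A>. \<A> \<subseteq> Fpow (Field \<theta>) \<and> disjoint \<A> \<and> |\<A>| =o \<theta> \<longrightarrow>
      (\<exists>a\<in>\<A>. \<exists>b\<in>\<A>. a \<noteq> b \<and> (\<forall>\<beta>\<in>b. a \<subseteq> underS \<theta> \<beta> - F \<xi> \<beta>)))"
proof -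
  have *: "(\<forall>\<alpha>\<in>a. \<forall>\<beta>\<in>b. \<alpha> \<in> underS \<theta> \<beta>) \<and> (\<forall>\<alpha>\<in>a. \<forall>\<beta>\<in>b. \<xi> \<in> underS \<mu> (matrix_rho \<mu> F \<alpha> \<beta>))
      \<longleftrightarrow> (\<forall>\<beta>\<in>b. a \<subseteq> underS \<theta> \<beta> - F \<xi> \<beta>)"
    if "\<xi> \<in> Field \<mu>" "b \<subseteq> Field \<theta>" for \<xi> a b
    using less_matrix_rho_iff[OF assms that(1)] that(2) by blast
  have "(\<exists>a\<in>\<A>. \<exists>b\<in>\<A>. a \<noteq> b \<and> (\<forall>\<alpha>\<in>a. \<forall>\<beta>\<in>b. \<alpha> \<in> underS \<theta> \<beta>) \<and>
        (\<forall>\<alpha>\<in>a. \<forall>\<beta>\<in>b. \<xi> \<in> underS \<mu> (matrix_rho \<mu> F \<alpha> \<beta>))) \<longleftrightarrow>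
      (\<exists>a\<in>\<A>. \<exists>b\<in>\<A>. a \<noteq> b \<and> (\<forall>\<beta>\<in>b. a \<subseteq> underS \<theta> \<beta> - F \<xi> \<beta>))"
    if "\<xi> \<in> Field \<mu>" "\<A> \<subseteq> Fpow (Field \<theta>)" for \<xi> \<A>
  proof (intro bex_cong conj_cong refl)
    fix b a assume "b \<in> \<A>"
    then have "b \<subseteq> Field \<theta>" using that(2) by (auto simp: Fpow_def)
    then show "(\<forall>\<alpha>\<in>a. \<forall>\<beta>\<in>b. \<alpha> \<in> underS \<theta> \<beta>) \<and>
        (\<forall>\<alpha>\<in>a. \<forall>\<beta>\<in>b. \<xi> \<in> underS \<mu> (matrix_rho \<mu> F \<alpha> \<beta>)) \<longleftrightarrow>
        (\<forall>\<beta>\<in>b. a \<subseteq> underS \<theta> \<beta> - F \<xi> \<beta>)"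
      by (rule *[OF that(1)])
  qed
  then show ?thesis
    unfolding unbounded_matrix_def unbounded_function_def
    by (intro ball_cong refl all_cong1 imp_cong) simp_all
qed

section \<open>From the Frechet property to unboundedness\<close>

lemma frechet_imp_unbounded:
  assumes \<theta>: "Cinfinite \<theta>" "regularCard \<theta>" and \<mu>: "Well_order \<mu>" "\<mu> <o \<theta>" "Field \<mu> \<noteq> {}"
    and F: "strong_matrix \<theta> \<mu> F"
    and fr: "frechet_group \<mu> (finset_group (Field \<theta>)) (matrix_topology \<theta> \<mu> F)"
  shows "unbounded_matrix \<theta> \<mu> F"
  unfolding unbounded_matrix_iff[OF \<mu>(1) F]
proof (intro ballI allI impI)
  fix \<xi> \<A> assume \<xi>: "\<xi> \<in> Field \<mu>" and \<A>: "\<A> \<subseteq> Fpow (Field \<theta>) \<and> disjoint \<A> \<and> |\<A>| =o \<theta>"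
  have co: "Card_order \<theta>" and ne: "Field \<theta> \<noteq> {}" using \<theta>(1) by (auto simp: cinfinite_def)
  interpret t: wo_rel \<theta> using card_order_on_well_order_on[OF co] by (simp add: wo_rel_def)
  interpret m: wo_rel \<mu> using \<mu>(1) by (simp add: wo_rel_def)
  have large: "\<not> |\<A>| <o \<theta>" using \<A> not_ordLess_ordIso by blast
  \<comment> \<open>By (G1), \<open>F \<eta> \<alpha>\<close> lies in a proper initial segment,
    which has fewer than \<open>\<theta>\<close> elements.\<close>
  have cl: "\<exists>a\<in>\<A>. a \<inter> F \<eta> \<alpha> = {}" if "\<eta> \<in> Field \<mu>" "\<alpha> \<in> Field \<theta>" for \<eta> \<alpha>
  proof -
    have "F \<eta> \<alpha> \<subseteq> underS \<theta> \<alpha>" using F that unfolding strong_matrix_def by blast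
    then have "|F \<eta> \<alpha>| <o \<theta>" using card_of_underS[OF co that(2)] by (rule ordLess_mono)
    then show ?thesis using ex_disjoint_member_avoiding[OF \<theta>(1) _ large] \<A> by blast
  qed
  have "\<A> \<subseteq> Fpow (Field \<theta>)" "\<forall>\<eta>\<in>Field \<mu>. \<forall>\<alpha>\<in>Field \<theta>. \<exists>a\<in>\<A>. a \<inter> F \<eta> \<alpha> = {}"
    using \<A> cl by auto
  from fr[unfolded frechet_group_matrix_iff[OF t.WELL \<mu>(1) ne \<mu>(3) F], THEN spec, THEN mp,
      OF this(1), THEN mp, OF this(2)]
  obtain x where x: "\<forall>\<zeta>\<in>Field \<mu>. x \<zeta> \<in> \<A>"
      "\<forall>\<eta>\<in>Field \<mu>. \<forall>\<alpha>\<in>Field \<theta>. \<exists>\<eta>'\<in>Field \<mu>. \<forall>\<zeta>. (\<eta>', \<zeta>) \<in> \<mu> \<longrightarrow> x \<zeta> \<inter> F \<eta> \<alpha> = {}"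
    by blast
  have fin: "finite (x \<zeta>)" "x \<zeta> \<subseteq> Field \<theta>" if "\<zeta> \<in> Field \<mu>" for \<zeta>
    using x(1) \<A> that by (auto simp: Fpow_def)
  define X where "X = (\<Union>\<zeta>\<in>Field \<mu>. x \<zeta>)"
  \<comment> \<open>The downward closure of all terms of the sequence is still smaller than
    \<open>\<theta>\<close> by regularity. By linearity, a set disjoint from it lies above every
    term.\<close>
  define Y where "Y = X \<union> (\<Union>\<gamma>\<in>X. underS \<theta> \<gamma>)"
  have "|Field \<mu>| <o \<theta>"
    using card_of_least[OF \<mu>(1)] \<mu>(2) by (rule ordLeq_ordLess_trans)
  then have X: "|X| <o \<theta>"
    unfolding X_def using fin(1) card_of_finite_ordLess_Cinfinite[OF \<theta>(1)]
    by (intro UNION_ordLess_regularCard[OF \<theta>(1,2)]) auto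
  have "X \<subseteq> Field \<theta>" using fin(2) by (auto simp: X_def)
  then have "|\<Union>\<gamma>\<in>X. underS \<theta> \<gamma>| <o \<theta>"
    using card_of_underS[OF co]
    by (intro UNION_ordLess_regularCard[OF \<theta>(1,2) X]) auto
  then have "|Y| <o \<theta>" unfolding Y_def by (rule ordLess_Un_Cinfinite[OF \<theta>(1) X])
  then obtain b where b: "b \<in> \<A>" "b \<noteq> {}" "b \<inter> Y = {}"
    using ex_disjoint_member_avoiding[OF \<theta>(1) _ large] \<A> by blast
  have bF: "finite b" "b \<subseteq> Field \<theta>" using b(1) \<A> by (auto simp: Fpow_def)
  have below: "x \<zeta> \<subseteq> underS \<theta> \<beta>" if "\<zeta> \<in> Field \<mu>" "\<beta> \<in> b" for \<zeta> \<beta>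
  proof
    fix \<gamma> assume g: "\<gamma> \<in> x \<zeta>"
    then have "\<gamma> \<in> X" using that by (auto simp: X_def)
    then have "\<beta> \<noteq> \<gamma>" "\<beta> \<notin> underS \<theta> \<gamma>" using b(3) that(2) by (auto simp: Y_def)
    moreover have "\<beta> \<in> Field \<theta>" "\<gamma> \<in> Field \<theta>" using that bF(2) g fin(2) by auto
    ultimately show "\<gamma> \<in> underS \<theta> \<beta>" using t.TOTALS unfolding underS_def by blast
  qed
  \<comment> \<open>Convergence gives one tail for each \<open>\<beta>\<close>; finitely many tails
    of the linear order \<open>\<mu>\<close> have a common one.\<close>
  have "\<exists>\<eta>\<in>Field \<mu>. \<forall>\<zeta>. (\<eta>, \<zeta>) \<in> \<mu> \<longrightarrow> (\<forall>\<beta>\<in>b. x \<zeta> \<inter> F \<xi> \<beta> = {})"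
    using bF
  proof (induction rule: finite_induct)
    case empty
    then show ?case using \<xi> by blast
  next
    case (insert \<beta> c)
    obtain \<eta>1 \<eta>2 where e: "\<eta>1 \<in> Field \<mu>" "\<forall>\<zeta>. (\<eta>1, \<zeta>) \<in> \<mu> \<longrightarrow> (\<forall>\<beta>\<in>c. x \<zeta> \<inter> F \<xi> \<beta> = {})"
        "\<eta>2 \<in> Field \<mu>" "\<forall>\<zeta>. (\<eta>2, \<zeta>) \<in> \<mu> \<longrightarrow> x \<zeta> \<inter> F \<xi> \<beta> = {}"
      using insert x(2) \<xi> by (meson insert_subset)
    consider "(\<eta>1, \<eta>2) \<in> \<mu>" | "(\<eta>2, \<eta>1) \<in> \<mu>" using e(1,3) m.TOTALS by blast
    then show ?case using e m.TRANS unfolding trans_def by cases blast+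
  qed
  then obtain \<eta> where \<eta>: "\<eta> \<in> Field \<mu>" "\<forall>\<beta>\<in>b. x \<eta> \<inter> F \<xi> \<beta> = {}"
    using m.REFL unfolding refl_on_def by blast
  have "\<forall>\<beta>\<in>b. x \<eta> \<subseteq> underS \<theta> \<beta> - F \<xi> \<beta>" using below[OF \<eta>(1)] \<eta>(2) by blast
  \<comment> \<open>If they were equal, a point of the nonempty set \<open>b\<close> would lie
    strictly below itself.\<close>
  moreover have "x \<eta> \<noteq> b"
    using b(2) below[OF \<eta>(1)] by (auto simp: underS_def)
  ultimately show "\<exists>a\<in>\<A>. \<exists>b\<in>\<A>. a \<noteq> b \<and> (\<forall>\<beta>\<in>b. a \<subseteq> underS \<theta> \<beta> - F \<xi> \<beta>)"
    using x(1) \<eta>(1) b(1) by blast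
qed

section \<open>From unboundedness to the Frechet property\<close>

text \<open>This confines the choice of a sequence to members of \<open>A\<close> below one ordinal
  \<open>\<alpha>\<close>, where the increasing sets \<open>F \<xi> \<alpha>\<close> alone control
  convergence.\<close>

lemma unbounded_reflecting_level:
  assumes \<theta>: "Cinfinite \<theta>" "regularCard \<theta>" "natLeq <o \<theta>"
    and \<mu>: "Well_order \<mu>" "\<mu> <o \<theta>"
    and F: "strong_matrix \<theta> \<mu> F" and un: "unbounded_matrix \<theta> \<mu> F"
    and A: "A \<subseteq> Fpow (Field \<theta>)" "\<And>\<xi> \<alpha>. \<xi> \<in> Field \<mu> \<Longrightarrow> \<alpha> \<in> Field \<theta> \<Longrightarrow> \<exists>a\<in>A. a \<inter> F \<xi> \<alpha> = {}"
  shows "\<exists>\<alpha>\<in>Field \<theta>. \<forall>\<xi>\<in>Field \<mu>. \<exists>a\<in>A. a \<subseteq> underS \<theta> \<alpha> \<and> a \<inter> F \<xi> \<alpha> = {}"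
proof (rule ccontr)
  assume "\<not> ?thesis"
  then obtain f where f: "\<forall>\<alpha>\<in>Field \<theta>. f \<alpha> \<in> Field \<mu> \<and>
      (\<forall>a\<in>A. a \<subseteq> underS \<theta> \<alpha> \<longrightarrow> a \<inter> F (f \<alpha>) \<alpha> \<noteq> {})"
    by metis
  have co: "Card_order \<theta>" using \<theta>(1) by simp
  interpret t: wo_rel \<theta> using card_order_on_well_order_on[OF co] by (simp add: wo_rel_def)
  have "|Field \<mu>| <o \<theta>"
    using card_of_least[OF \<mu>(1)] \<mu>(2) by (rule ordLeq_ordLess_trans)
  moreover have "\<not> |Field \<theta>| <o \<theta>" using card_of_Field_ordIso[OF co] not_ordLess_ordIso by blast
  moreover have "f ` Field \<theta> \<subseteq> Field \<mu>" using f by blast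
  ultimately obtain \<xi> where \<xi>: "\<xi> \<in> Field \<mu>" "\<not> |{\<alpha> \<in> Field \<theta>. f \<alpha> = \<xi>}| <o \<theta>"
    using pigeonhole_regularCard[OF \<theta>(1,2), of "Field \<theta>" "Field \<mu>" f] by auto
  define S where "S = {\<alpha> \<in> Field \<theta>. f \<alpha> = \<xi>}"
  obtain a where a: "\<And>\<alpha>. \<alpha> \<in> S \<Longrightarrow> a \<alpha> \<in> A \<and> a \<alpha> \<inter> F \<xi> \<alpha> = {}"
    using A(2)[OF \<xi>(1)] unfolding S_def by (metis (mono_tags, lifting) mem_Collect_eq)
  \<comment> \<open>Adding \<open>\<alpha>\<close> puts it into its own petal, so that the inclusion
    obtained for all points of the petal of \<open>\<beta>\<close> applies to \<open>\<beta>\<close>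
    itself.\<close>
  define c where "c \<alpha> = insert \<alpha> (a \<alpha>)" for \<alpha>
  have cF: "finite (c \<alpha>)" "c \<alpha> \<subseteq> Field \<theta>" if "\<alpha> \<in> S" for \<alpha>
    using a[OF that] A(1) that by (auto simp: c_def S_def Fpow_def)
  obtain J R where J: "J \<subseteq> S" "\<not> |J| <o \<theta>"
      "\<And>\<alpha> \<beta>. \<alpha> \<in> J \<Longrightarrow> \<beta> \<in> J \<Longrightarrow> \<alpha> \<noteq> \<beta> \<Longrightarrow> c \<alpha> \<inter> c \<beta> = R"
    using delta_system[OF \<theta> \<xi>(2)[folded S_def], of c] cF(1) by metis
  have R: "R \<subseteq> c \<alpha>" if "\<alpha> \<in> J" for \<alpha>
  proof -
    have "J \<noteq> {\<alpha>}" using J(2) card_of_finite_ordLess_Cinfinite[OF \<theta>(1), of "{\<alpha>}"] by auto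
    then show ?thesis using that J(3) by blast
  qed
  have "J \<noteq> {}" using J(2) card_of_finite_ordLess_Cinfinite[OF \<theta>(1), of "{}"] by auto
  then have RF: "finite R" "R \<subseteq> Field \<theta>"
    using R cF J(1) by (meson ex_in_conv finite_subset subset_trans subsetD)+
  \<comment> \<open>An index outside \<open>K\<close> is at most some point of the finite root
    \<open>R\<close>, so fewer than \<open>\<theta>\<close> indices are lost.\<close>
  define K where "K = {\<alpha> \<in> J. R \<subseteq> underS \<theta> \<alpha>}"
  have "|R \<union> (\<Union>\<gamma>\<in>R. underS \<theta> \<gamma>)| <o \<theta>"
    using RF card_of_underS[OF co] card_of_finite_ordLess_Cinfinite[OF \<theta>(1)]
    by (intro ordLess_Un_Cinfinite[OF \<theta>(1)]
        UNION_ordLess_regularCard[OF \<theta>(1,2)]) auto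
  moreover have "J \<subseteq> K \<union> (R \<union> (\<Union>\<gamma>\<in>R. underS \<theta> \<gamma>))"
    using J(1) RF(2) t.TOTALS unfolding K_def S_def underS_def by blast
  ultimately have K: "\<not> |K| <o \<theta>" using not_ordLess_diff[OF \<theta>(1) J(2)] by blast
  define b where "b \<alpha> = c \<alpha> - R" for \<alpha>
  have self: "\<alpha> \<in> b \<alpha>" if "\<alpha> \<in> K" for \<alpha>
    using that by (auto simp: b_def c_def K_def underS_def)
  have dis: "b \<alpha> \<inter> b \<beta> = {}" if "\<alpha> \<in> K" "\<beta> \<in> K" "\<alpha> \<noteq> \<beta>" for \<alpha> \<beta>
    using J(3)[of \<alpha> \<beta>] that by (auto simp: b_def K_def)
  have "inj_on b K" using self dis unfolding inj_on_def by blast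
  then have "|K| =o |b ` K|" by (intro card_of_ordIsoI[of b]) (simp add: bij_betw_def)
  then have "|b ` K| =o |K|" by (rule ordIso_symmetric)
  moreover have "|K| =o \<theta>"
  proof -
    have "K \<subseteq> Field \<theta>" using J(1) by (auto simp: K_def S_def)
    then have "|K| \<le>o \<theta>"
      using card_of_mono1 card_of_Field_ordIso[OF co] by (blast intro: ordLeq_ordIso_trans)
    then show ?thesis using K ordLeq_iff_ordLess_or_ordIso by blast
  qed
  ultimately have card: "|b ` K| =o \<theta>" by (rule ordIso_transitive)
  have "b ` K \<subseteq> Fpow (Field \<theta>)"
    using cF J(1) by (auto simp: b_def K_def Fpow_def)
  moreover have "disjoint (b ` K)" using dis unfolding disjoint_def by blast
  ultimately have "b ` K \<subseteq> Fpow (Field \<theta>) \<and> disjoint (b ` K) \<and> |b ` K| =o \<theta>"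
    using card by blast
  from un[unfolded unbounded_matrix_iff[OF \<mu>(1) F], THEN bspec, OF \<xi>(1), THEN spec, THEN mp, OF this]
  obtain \<alpha> \<beta> where h: "\<alpha> \<in> K" "\<beta> \<in> K" "b \<alpha> \<noteq> b \<beta>"
      "\<forall>\<gamma>\<in>b \<beta>. b \<alpha> \<subseteq> underS \<theta> \<gamma> - F \<xi> \<gamma>"
    by blast
  have S: "\<alpha> \<in> S" "\<beta> \<in> S" using h(1,2) J(1) by (auto simp: K_def)
  have "b \<alpha> \<subseteq> underS \<theta> \<beta> - F \<xi> \<beta>" using h(4) self[OF h(2)] by blast
  \<comment> \<open>Unboundedness says nothing about the root. But \<open>R\<close> lies below
    \<open>\<beta>\<close>, hence does not contain \<open>\<beta>\<close> and is part of
    \<open>a \<beta>\<close>, which was chosen to miss \<open>F \<xi> \<beta>\<close>.\<close>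
  moreover have "R \<subseteq> underS \<theta> \<beta> - F \<xi> \<beta>"
  proof -
    have "R \<subseteq> underS \<theta> \<beta>" using h(2) by (simp add: K_def)
    moreover have "R \<subseteq> a \<beta>" using R[of \<beta>] h(2) by (auto simp: K_def c_def underS_def)
    ultimately show ?thesis using a[OF S(2)] by blast
  qed
  ultimately have "a \<alpha> \<subseteq> underS \<theta> \<beta> - F \<xi> \<beta>" unfolding b_def c_def by blast
  then have "a \<alpha> \<subseteq> underS \<theta> \<beta>" "a \<alpha> \<inter> F \<xi> \<beta> = {}" by blast+
  moreover have "\<beta> \<in> Field \<theta>" "f \<beta> = \<xi>" using S(2) by (simp_all add: S_def)
  ultimately show False using f a[OF S(1)] by blast
qed

lemma unbounded_imp_frechet:
  assumes \<theta>: "Cinfinite \<theta>" "regularCard \<theta>" "natLeq <o \<theta>"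
    and \<mu>: "Well_order \<mu>" "\<mu> <o \<theta>" "Field \<mu> \<noteq> {}"
    and F: "strong_matrix \<theta> \<mu> F" and un: "unbounded_matrix \<theta> \<mu> F"
  shows "frechet_group \<mu> (finset_group (Field \<theta>)) (matrix_topology \<theta> \<mu> F)"
proof -
  have co: "Card_order \<theta>" and ne: "Field \<theta> \<noteq> {}" using \<theta>(1) by (auto simp: cinfinite_def)
  interpret t: wo_rel \<theta> using card_order_on_well_order_on[OF co] by (simp add: wo_rel_def)
  show ?thesis
    unfolding frechet_group_matrix_iff[OF t.WELL \<mu>(1) ne \<mu>(3) F]
  proof (intro allI impI)
    fix A assume A: "A \<subseteq> Fpow (Field \<theta>)" "\<forall>\<xi>\<in>Field \<mu>. \<forall>\<alpha>\<in>Field \<theta>. \<exists>a\<in>A. a \<inter> F \<xi> \<alpha> = {}"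
    obtain \<alpha> where \<alpha>: "\<alpha> \<in> Field \<theta>" "\<forall>\<xi>\<in>Field \<mu>. \<exists>a\<in>A. a \<subseteq> underS \<theta> \<alpha> \<and> a \<inter> F \<xi> \<alpha> = {}"
      using unbounded_reflecting_level[OF \<theta> \<mu>(1,2) F un A(1)] A(2) by blast
    then obtain x where x: "\<And>\<xi>. \<xi> \<in> Field \<mu> \<Longrightarrow> x \<xi> \<in> A \<and> x \<xi> \<subseteq> underS \<theta> \<alpha> \<and> x \<xi> \<inter> F \<xi> \<alpha> = {}"
      by metis
    have "\<exists>\<eta>\<in>Field \<mu>. \<forall>\<zeta>. (\<eta>, \<zeta>) \<in> \<mu> \<longrightarrow> x \<zeta> \<inter> F \<xi> \<beta> = {}"
      if h: "\<xi> \<in> Field \<mu>" "\<beta> \<in> Field \<theta>" for \<xi> \<beta>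
    proof -
      \<comment> \<open>All terms of \<open>x\<close> lie below \<open>\<alpha>\<close>, so only the
        trace of \<open>F \<xi> \<beta>\<close> there matters. One level at \<open>\<alpha>\<close>
        covers it, by (G4) if \<open>\<alpha> \<le> \<beta>\<close> and by (G3) otherwise; by (G2)
        all later terms then miss it.\<close>
      have "\<exists>\<eta>\<in>Field \<mu>. F \<xi> \<beta> \<inter> underS \<theta> \<alpha> \<subseteq> F \<eta> \<alpha>"
      proof (cases "(\<alpha>, \<beta>) \<in> \<theta>")
        case True
        then show ?thesis using F h(1) unfolding strong_matrix_def by blast
      next
        case False
        then have "(\<beta>, \<alpha>) \<in> \<theta>" using h(2) \<alpha>(1) t.TOTALS by blast
        then have "\<exists>\<eta>\<in>Field \<mu>. F \<xi> \<beta> \<subseteq> F \<eta> \<alpha>" using F h(1) unfolding strong_matrix_def by blast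
        then show ?thesis by blast
      qed
      then obtain \<eta> where \<eta>: "\<eta> \<in> Field \<mu>" "F \<xi> \<beta> \<inter> underS \<theta> \<alpha> \<subseteq> F \<eta> \<alpha>" by blast
      have "x \<zeta> \<inter> F \<xi> \<beta> = {}" if z: "(\<eta>, \<zeta>) \<in> \<mu>" for \<zeta>
      proof -
        have "F \<eta> \<alpha> \<subseteq> F \<zeta> \<alpha>" using F z \<alpha>(1) unfolding strong_matrix_def by blast
        moreover have "\<zeta> \<in> Field \<mu>" using z by (auto simp: Field_def)
        ultimately show ?thesis using x[of \<zeta>] \<eta>(2) by blast
      qed
      then show ?thesis using \<eta>(1) by blast
    qed
    then show "\<exists>x. (\<forall>\<zeta>\<in>Field \<mu>. x \<zeta> \<in> A) \<and>
        (\<forall>\<xi>\<in>Field \<mu>. \<forall>\<alpha>\<in>Field \<theta>. \<exists>\<eta>\<in>Field \<mu>. \<forall>\<zeta>. (\<eta>, \<zeta>) \<in> \<mu> \<longrightarrow> x \<zeta> \<inter> F \<xi> \<alpha> = {})"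
      using x by blast
  qed
qed

theorem theorem4p2:
  fixes \<mu> :: "'l rel" and \<kappa> :: "'k rel" and \<theta> :: "'a rel"
    and F :: "'l \<Rightarrow> 'a \<Rightarrow> 'a set"
  assumes "Cinfinite \<mu>" and "regularCard \<mu>"
    and "Cinfinite \<kappa>" and "regularCard \<kappa>"
    and "\<mu> \<le>o \<kappa>"
    and "\<theta> =o cardSuc \<kappa>"
    and "strong_matrix \<theta> \<mu> F"
  shows "frechet_group \<mu> (finset_group (Field \<theta>)) (matrix_topology \<theta> \<mu> F) \<longleftrightarrow>
    unbounded_matrix \<theta> \<mu> F"
proof -
  \<comment> \<open>Regularity and size of \<open>\<theta>\<close> are transferred from the
    successor of \<open>\<kappa>\<close>; uncountability, used for the delta-system, follows since
    \<open>\<kappa>\<close> is infinite.\<close>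
  have \<theta>: "cardSuc \<kappa> =o \<theta>" using assms(6) by (rule ordIso_symmetric)
  have inf: "Cinfinite \<theta>" using Cinfinite_cong[OF \<theta> Cinfinite_cardSuc[OF assms(3)]] .
  have reg: "regularCard \<theta>"
    using regularCard_ordIso[OF \<theta> Cinfinite_cardSuc regularCard_cardSuc] assms(3) by blast
  have less: "\<kappa> <o \<theta>"
    using cardSuc_greater[of \<kappa>] assms(3) \<theta> ordLess_ordIso_trans by blast
  have "natLeq \<le>o \<kappa>" using natLeq_ordLeq_cinfinite[OF assms(3)] .
  then have unc: "natLeq <o \<theta>" using less by (rule ordLeq_ordLess_trans)
  have lt: "\<mu> <o \<theta>" using assms(5) less by (rule ordLeq_ordLess_trans)
  have wo: "Well_order \<mu>" using assms(1) card_order_on_well_order_on by blast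
  have ne: "Field \<mu> \<noteq> {}" using assms(1) by (auto simp: cinfinite_def)
  show ?thesis
    using frechet_imp_unbounded[OF inf reg wo lt ne assms(7)]
      unbounded_imp_frechet[OF inf reg unc wo lt ne assms(7)] by blast
qed

end
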